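(* Let $A\in\mathbb{R}^{n\times n}$ be unstable, $B\in\mathbb{R}^{n\times m}$, $K\in\mathbb{R}^{m\times n}$, and consider the closed-loop networked control system $$x(t+1)=Ax(t)+(1-l(t))BKx(t)+w(t),\quad t\in\mathbb{N}_0,\qquad x(0)=x_0,$$ with transmission failure indicator $l(t)=\mathbb{1}[r(t)\le p(\phi_{\mathrm J}(t))]$, where $p$, $r$, $\phi_{\mathrm J}$, $w$ and the concave upper bound $\hat p\ge p$ are as in the context. Let $\|\cdot\|$ be the matrix norm on $\mathbb{R}^{n\times n}$ induced by some vector norm on $\mathbb{R}^n$. Suppose that there exist scalars $\hat\kappa\ge0$ and $\hat\phi_{\mathrm J}\ge0$ such that $$\mathbb{P}\Big[\sum_{i=t_1}^{t_2-1}\phi_{\mathrm J}(i)\le\hat\kappa+\hat\phi_{\mathrm J}(t_2-t_1)\Big]=1\quad\text{for all }t_1,t_2\in\mathbb{N}_0\text{ with }t_1<t_2.$$ Furthermore, suppose $\mathbb{E}[\|w(t)\|_2^2]<\infty$ for all $t\in\mathbb{N}_0$. If $$(1-\hat p(\hat\phi_{\mathrm J}))\|A+BK\|^2+\hat p(\hat\phi_{\mathrm J})\|A\|^2<1,$$ then there exist $\hat\mu\ge0$, $\hat f\ge0$, and $\hat\theta\in(0,1)$ such that, for every initial state $x_0\in\mathbb{R}^n$, $$\mathbb{E}[\|x(t)\|_2]\le\hat\mu\hat\theta^{t}\|x_0\|_2+\hat f\max_{i\in\{0,\ldots,t-1\}}\big(\mathbb{E}[\|w(i)\|_2^2]\big)^{\frac12},\quad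 t\in\mathbb{N}.$$
   Context: $\mathbb{N}$ and $\mathbb{N}_0$ denote the positive and the nonnegative integers; $\|\cdot\|_2$ is the Euclidean norm. All random variables live on a probability space $(\Omega,\mathcal F,\mathbb P)$ with expectation $\mathbb E$. The induced matrix norm is $\|M\|=\sup_{x\neq0}\|Mx\|/\|x\|$. Unstable: $\sup_{t\in\mathbb{N}}\|A^t\|=\infty$; in particular $\|A\|>1$ for every induced matrix norm. Transmission failure model: $p\colon[0,\infty)\to[0,1]$ is a Borel-measurable nondecreasing function. $r(0),r(1),\ldots$ are independent random variables uniformly distributed in $[0,1]$. $\{\phi_{\mathrm J}(t)\in[0,\infty)\}_{t\in\mathbb{N}_0}$ is a stochastic process (the attacker's jamming interference power), and the processes $\{r(t)\}_{t\in\mathbb{N}_0}$ and $\{\phi_{\mathrm J}(t)\}_{t\in\mathbb{N}_0}$ are mutually independent. $l(t)=\mathbb{1}[r(t)\le p(\phi_{\mathrm J}(t))]\in\{0,1\}$, with $l(t)=1$ indicating a transmission failure. $\hat p\colon[0,\infty)\to[0,1]$ is a continuous, nondecreasing, concave function with $\hat p(\phi)\ge p(\phi)$ for all $\phi\in[0,\infty)$. The disturbance $\{w(t)\in\mathbb{R}^n\}_{t\in\mathbb{N}_0}$ is a stochastic process; it need not be independent of $\{l(t)\}$. The initial state $x_0\in\mathbb{R}^n$ is deterministic. *)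

theory Defs
  imports "HOL-Probability.Probability"
begin

definition is_vector_norm :: "(real^'n \<Rightarrow> real) \<Rightarrow> bool" where
  "is_vector_norm N \<longleftrightarrow>
     (\<forall>x. 0 \<le> N x) \<and> (\<forall>x. N x = 0 \<longleftrightarrow> x = 0) \<and>
     (\<forall>c x. N (c *\<^sub>R x) = \<bar>c\<bar> * N x) \<and> (\<forall>x y. N (x + y) \<le> N x + N y)"

text \<open>
  The supremum is taken in the reals; it is a genuine supremum by
  \<open>bdd_above_induced_matrix_norm\<close> below.
\<close>

definition induced_matrix_norm :: "(real^'n \<Rightarrow> real) \<Rightarrow> real^'n^'n \<Rightarrow> real" where
  "induced_matrix_norm N M = (SUP x\<in>- {0}. N (M *v x) / N x)"

text \<open>The power operation of the library acts componentwise on vectors and matrices.\<close>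

primrec matrix_power :: "real^'n^'n \<Rightarrow> nat \<Rightarrow> real^'n^'n" where
  "matrix_power A 0 = mat 1"
| "matrix_power A (Suc t) = A ** matrix_power A t"

text \<open>
  Instability does not depend on the vector norm; it is stated with the Euclidean one,
  and \<open>unstable_iff\<close> below gives the same characterization for every other norm.
\<close>

definition unstable :: "real^'n^'n \<Rightarrow> bool" where
  "unstable A \<longleftrightarrow> (SUP t\<in>{1..}. ereal (induced_matrix_norm norm (matrix_power A t))) = \<infinity>"

definition failure_indicator ::
  "(real \<Rightarrow> real) \<Rightarrow> (nat \<Rightarrow> 'a \<Rightarrow> real) \<Rightarrow> (nat \<Rightarrow> 'a \<Rightarrow> real) \<Rightarrow> nat \<Rightarrow> 'a \<Rightarrow> real" where
  "failure_indicator p r \<phi> t \<omega> = of_bool (r t \<omega> \<le> p (\<phi> t \<omega>))"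

primrec closed_loop_state ::
  "real^'n^'n \<Rightarrow> real^'m^'n \<Rightarrow> real^'n^'m \<Rightarrow> (nat \<Rightarrow> 'a \<Rightarrow> real) \<Rightarrow> (nat \<Rightarrow> 'a \<Rightarrow> real^'n) \<Rightarrow>
    real^'n \<Rightarrow> nat \<Rightarrow> 'a \<Rightarrow> real^'n" where
  "closed_loop_state A B K l w x0 0 \<omega> = x0"
| "closed_loop_state A B K l w x0 (Suc t) \<omega> =
     A *v closed_loop_state A B K l w x0 t \<omega>
     + (1 - l t \<omega>) *\<^sub>R (B *v (K *v closed_loop_state A B K l w x0 t \<omega>))
     + w t \<omega>"

lemma is_vector_norm_norm: "is_vector_norm norm"
  by (auto simp: is_vector_norm_def norm_triangle_ineq)

lemma is_vector_norm_equiv: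
  assumes "is_vector_norm (N :: real^'n \<Rightarrow> real)"
  obtains c C where "0 < c" "0 < C" "\<And>x. c * norm x \<le> N x" "\<And>x. N x \<le> C * norm x"
proof -
  have nonneg: "0 \<le> N x" and zero: "N x = 0 \<longleftrightarrow> x = 0"
    and scale: "N (a *\<^sub>R x) = \<bar>a\<bar> * N x" and tri: "N (x + y) \<le> N x + N y" for a x y
    using assms unfolding is_vector_norm_def by auto
  define C where "C = (\<Sum>i\<in>Basis. N i) + 1"
  have Cpos: "0 < C" unfolding C_def using sum_nonneg[of Basis N] nonneg by (simp add: add_nonneg_pos)
  have tri_sum: "N (\<Sum>i\<in>S. f i) \<le> (\<Sum>i\<in>S. N (f i))" if "finite S" for S and f :: "_ \<Rightarrow> real^'n"
    using that
  proof (induction S rule: finite_induct)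
    case empty
    then show ?case using zero[of 0] by simp
  next
    case (insert a S)
    then show ?case using tri[of "f a" "\<Sum>i\<in>S. f i"] by simp
  qed
  have upper: "N x \<le> C * norm x" for x
  proof -
    have "N x = N (\<Sum>i\<in>Basis. (x \<bullet> i) *\<^sub>R i)" by (simp add: euclidean_representation)
    also have "\<dots> \<le> (\<Sum>i\<in>Basis. \<bar>x \<bullet> i\<bar> * N i)"
      using tri_sum[of Basis "\<lambda>i. (x \<bullet> i) *\<^sub>R i"] by (simp add: scale)
    also have "\<dots> \<le> (\<Sum>i\<in>Basis. norm x * N i)"
      by (intro sum_mono mult_right_mono nonneg) (simp add: Basis_le_norm)
    also have "\<dots> = norm x * (\<Sum>i\<in>Basis. N i)" by (simp add: sum_distrib_left)
    also have "\<dots> \<le> norm x * C" unfolding C_def by (intro mult_left_mono) auto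
    finally show ?thesis by (simp add: mult.commute)
  qed
  have lip: "dist (N x) (N y) \<le> C * dist x y" for x y
  proof -
    have "N x \<le> N y + N (x - y)" using tri[of y "x - y"] by simp
    moreover have "N y \<le> N x + N (y - x)" using tri[of x "y - x"] by simp
    ultimately show ?thesis using upper[of "x - y"] upper[of "y - x"]
      by (auto simp: dist_real_def dist_norm norm_minus_commute)
  qed
  have "C-lipschitz_on UNIV N" by (rule lipschitz_onI) (use lip Cpos in auto)
  then have cont: "continuous_on (sphere 0 1) N"
    by (meson lipschitz_on_continuous_on continuous_on_subset subset_UNIV)
  have ne: "sphere (0::real^'n) 1 \<noteq> {}" by simp
  obtain u where u: "u \<in> sphere 0 1" "\<And>y. y \<in> sphere 0 1 \<Longrightarrow> N u \<le> N y"
    using continuous_attains_inf[OF compact_sphere ne cont] by blast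
  have upos: "0 < N u" using u(1) nonneg[of u] zero[of u] by (cases "u = 0") auto
  have lower: "N u * norm x \<le> N x" for x
  proof (cases "x = 0")
    case False
    then have "N u \<le> N ((1 / norm x) *\<^sub>R x)" by (intro u(2)) simp
    also have "\<dots> = N x / norm x" by (simp only: scale) simp
    finally show ?thesis using False by (simp add: field_simps)
  next
    case True
    moreover have "N 0 = 0" using zero by blast
    ultimately show ?thesis by simp
  qed
  show thesis using that[OF upos Cpos lower upper] .
qed

lemma bdd_above_induced_matrix_norm:
  assumes "is_vector_norm N"
  shows "bdd_above ((\<lambda>x. N (M *v x) / N x) ` (- {0}))"
proof -
  obtain c C where cC: "0 < c" "0 < C" "\<And>x. c * norm x \<le> N x" "\<And>x. N x \<le> C * norm x"
    using is_vector_norm_equiv[OF assms] by blast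
  have "N (M *v x) / N x \<le> C * onorm ((*v) M) / c" if "x \<noteq> 0" for x
  proof -
    have "N (M *v x) \<le> C * (onorm ((*v) M) * norm x)"
      using cC(2,4) by (meson dual_order.trans less_imp_le matrix_vector_mul_bounded_linear
          mult_left_mono onorm)
    moreover have "0 \<le> onorm ((*v) M)" by (simp add: onorm_pos_le)
    ultimately have "N (M *v x) / N x \<le> C * (onorm ((*v) M) * norm x) / (c * norm x)"
      using cC that by (intro frac_le) auto
    then show ?thesis using that by simp
  qed
  then show ?thesis by (intro bdd_aboveI2) auto
qed

lemma induced_matrix_norm_compare:
  assumes "is_vector_norm N" "is_vector_norm N'"
  obtains D where "0 < D" "\<And>M. induced_matrix_norm N M \<le> D * induced_matrix_norm N' M"
proof -
  obtain c C where cC: "0 < c" "0 < C" "\<And>x. c * norm x \<le> N x" "\<And>x. N x \<le> C * norm x"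
    using is_vector_norm_equiv[OF assms(1)] by blast
  obtain c' C' where cC': "0 < c'" "0 < C'" "\<And>x. c' * norm x \<le> N' x" "\<And>x. N' x \<le> C' * norm x"
    using is_vector_norm_equiv[OF assms(2)] by blast
  define D where "D = (C / c') * (C' / c)"
  have D: "0 < D" using cC cC' by (simp add: D_def)
  have "induced_matrix_norm N M \<le> D * induced_matrix_norm N' M" for M
    unfolding induced_matrix_norm_def[of N]
  proof (rule cSUP_least)
    have "axis undefined (1::real) \<in> - {0}" by (simp add: axis_eq_0_iff)
    then show "- {0::real^'a} \<noteq> {}" by blast
    fix x :: "real^'a" assume x: "x \<in> - {0}"
    have pos: "0 < N x" "0 < N' x" "0 \<le> N' (M *v x)"
      using x assms unfolding is_vector_norm_def by (auto simp: less_le)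
    have *: "N y \<le> (C / c') * N' y" for y
    proof -
      have "N y \<le> C * norm y" by (rule cC)
      also have "\<dots> = (C / c') * (c' * norm y)" using cC' by simp
      also have "\<dots> \<le> (C / c') * N' y" using cC cC' by (intro mult_left_mono) auto
      finally show ?thesis .
    qed
    have **: "N' y \<le> (C' / c) * N y" for y
    proof -
      have "N' y \<le> C' * norm y" by (rule cC')
      also have "\<dots> = (C' / c) * (c * norm y)" using cC by simp
      also have "\<dots> \<le> (C' / c) * N y" using cC cC' by (intro mult_left_mono) auto
      finally show ?thesis .
    qed
    have "N (M *v x) / N x \<le> ((C / c') * N' (M *v x)) / N x"
      using *[of "M *v x"] pos by (intro divide_right_mono) auto
    also have "\<dots> \<le> ((C / c') * N' (M *v x)) / (N' x / (C' / c))"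
      using **[of x] pos cC cC' by (intro divide_left_mono) (auto simp: field_simps)
    also have "\<dots> = D * (N' (M *v x) / N' x)" by (simp add: D_def mult_ac)
    also have "\<dots> \<le> D * induced_matrix_norm N' M"
      unfolding induced_matrix_norm_def using D x bdd_above_induced_matrix_norm[OF assms(2)]
      by (intro mult_left_mono cSUP_upper) auto
    finally show "N (M *v x) / N x \<le> D * induced_matrix_norm N' M" .
  qed
  with D show thesis using that by blast
qed

lemma unstable_iff:
  assumes "is_vector_norm N"
  shows "unstable A \<longleftrightarrow> (SUP t\<in>{1..}. ereal (induced_matrix_norm N (matrix_power A t))) = \<infinity>"
proof -
  have *: "(SUP t\<in>{1..}. ereal (induced_matrix_norm N2 (matrix_power A t))) = \<infinity>"
    if N: "is_vector_norm N1" "is_vector_norm N2"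
      and inf: "(SUP t\<in>{1..}. ereal (induced_matrix_norm N1 (matrix_power A t))) = \<infinity>"
    for N1 N2
  proof -
    obtain D where D: "0 < D" "\<And>M. induced_matrix_norm N1 M \<le> D * induced_matrix_norm N2 M"
      using induced_matrix_norm_compare[OF N] by blast
    have "\<exists>t\<in>{1..}. ereal (real n) \<le> ereal (induced_matrix_norm N2 (matrix_power A t))" for n
    proof -
      have "ereal (D * real n) < (SUP t\<in>{1..}. ereal (induced_matrix_norm N1 (matrix_power A t)))"
        using inf by simp
      then obtain t where t: "t \<in> {1..}" "D * real n < induced_matrix_norm N1 (matrix_power A t)"
        unfolding less_SUP_iff by auto
      with D(2)[of "matrix_power A t"] have "D * real n < D * induced_matrix_norm N2 (matrix_power A t)"
        by linarith
      with D(1) t(1) show ?thesis by (intro bexI[of _ t]) auto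
    qed
    then show ?thesis by (rule SUP_PInfty)
  qed
  show ?thesis unfolding unstable_def
    using *[OF is_vector_norm_norm assms] *[OF assms is_vector_norm_norm] by blast
qed

end

(*
  Write a and b for the induced norms of A and A + BK. In the norm N the state grows in each step
  by a factor of at most a (failure) or b (success), so N (x t) is bounded by the variation of
  constants formula with products of these random factors. Conditioning on the jamming process makes
  the factors independent, and the second moment of a product over a window becomes the expectation
  of the product of b^2 + (a^2 - b^2) p(phi(s)). By AM-GM, concavity of the upper bound of p and the
  power budget, this product decays geometrically in the length of the window. Instability
  gives a > 1, hence b < 1 < a, which makes these weights monotone in p. As w may depend on the
  failures, the products are separated from w by Cauchy-Schwarz; this is why second moments are
  used to bound a first moment.
*)

theory Submission
  imports Defs
begin

section \<open>Induced norms and instability\<close>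

lemma induced_matrix_norm_bound:
  assumes N: "is_vector_norm N"
  shows "N (M *v x) \<le> induced_matrix_norm N M * N x"
proof (cases "x = 0")
  case True
  moreover have "N 0 = 0" using N unfolding is_vector_norm_def by blast
  ultimately show ?thesis by simp
next
  case False
  then have "N (M *v x) / N x \<le> induced_matrix_norm N M"
    unfolding induced_matrix_norm_def
    by (intro cSUP_upper bdd_above_induced_matrix_norm N) auto
  moreover have "0 < N x" using N False by (auto simp: is_vector_norm_def less_le)
  ultimately show ?thesis by (simp add: field_simps)
qed

lemma induced_matrix_norm_nonneg:
  assumes N: "is_vector_norm (N :: real^'n \<Rightarrow> real)"
  shows "0 \<le> induced_matrix_norm N M"
proof -
  define x :: "real^'n" where "x = axis undefined 1"
  have "x \<noteq> 0" by (simp add: x_def axis_eq_0_iff)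
  then have "0 < N x" using N by (auto simp: is_vector_norm_def less_le)
  moreover have "0 \<le> N (M *v x)" using N by (simp add: is_vector_norm_def)
  with induced_matrix_norm_bound[OF N, of M x] have "0 \<le> induced_matrix_norm N M * N x" by linarith
  ultimately show ?thesis by (simp add: zero_le_mult_iff)
qed

text \<open>If the norm of \<open>A\<close> were at most 1, no power of \<open>A\<close> could
  lengthen a vector, so all powers would have norm at most 1. Instability enters the theorem only in
  this form.\<close>

lemma unstable_imp_induced_matrix_norm_gt_1:
  assumes N: "is_vector_norm (N :: real^'n \<Rightarrow> real)" and "unstable A"
  shows "1 < induced_matrix_norm N A"
proof (rule ccontr)
  assume "\<not> ?thesis"
  then have le: "induced_matrix_norm N A \<le> 1" by simp
  have Npos: "0 \<le> N x" for x using N by (simp add: is_vector_norm_def)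
  have pow: "N (matrix_power A t *v x) \<le> N x" for t x
  proof (induction t)
    case (Suc t)
    have "N (A *v (matrix_power A t *v x)) \<le> induced_matrix_norm N A * N (matrix_power A t *v x)"
      by (rule induced_matrix_norm_bound[OF N])
    also have "\<dots> \<le> N (matrix_power A t *v x)"
      using le Npos by (simp add: mult_left_le_one_le induced_matrix_norm_nonneg[OF N])
    finally show ?case using Suc by (simp add: matrix_vector_mul_assoc)
  qed simp
  have "induced_matrix_norm N (matrix_power A t) \<le> 1" for t
    unfolding induced_matrix_norm_def
  proof (rule cSUP_least)
    have "axis undefined (1::real) \<in> - {0}" by (simp add: axis_eq_0_iff)
    then show "- {0::real^'n} \<noteq> {}" by blast
  next
    fix x :: "real^'n" assume "x \<in> - {0}"
    then have "0 < N x" using N by (auto simp: is_vector_norm_def less_le)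
    then show "N (matrix_power A t *v x) / N x \<le> 1" using pow[of t x] by simp
  qed
  then have "(SUP t\<in>{1..}. ereal (induced_matrix_norm N (matrix_power A t))) \<le> 1"
    by (intro SUP_least) simp
  then show False using \<open>unstable A\<close> unfolding unstable_iff[OF N] by simp
qed

section \<open>AM-GM and Cauchy-Schwarz\<close>

text \<open>AM-GM without roots: \<open>z \<le> exp (z - 1)\<close> at \<open>z = x i / c\<close>,
  multiplied over \<open>S\<close>, leaves the total exponent \<open>sum x S / c - card S\<close>,
  which is at most 0. Vanishing factors need no separate case.\<close>

lemma prod_le_power_of_sum_le:
  fixes x :: "'i \<Rightarrow> real" and c :: real
  assumes "finite S" "\<And>i. i \<in> S \<Longrightarrow> 0 \<le> x i" "0 < c" "sum x S \<le> card S * c"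
  shows "prod x S \<le> c ^ card S"
proof -
  have "prod x S \<le> (\<Prod>i\<in>S. c * exp (x i / c - 1))"
  proof (rule prod_mono, safe)
    fix i assume "i \<in> S"
    show "x i \<le> c * exp (x i / c - 1)"
      using exp_ge_add_one_self[of "x i / c - 1"] \<open>0 < c\<close> by (simp add: field_simps)
  qed (use assms in auto)
  also have "\<dots> = c ^ card S * exp (sum x S / c - card S)"
    using assms(1) by (simp add: prod.distrib flip: exp_sum)
      (simp add: sum_subtractf sum_divide_distrib)
  also have "\<dots> \<le> c ^ card S * 1"
    using assms(3,4) by (intro mult_left_mono) (auto simp: field_simps)
  finally show ?thesis by simp
qed

text \<open>Cauchy-Schwarz, by expanding the nonnegative integral of the square of
  \<open>\<beta> * U - \<alpha> * V\<close>, where the weights are the L2 norms of \<open>U\<close>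
  and \<open>V\<close>.\<close>

lemma integral_mult_le_sqrt_integral_squares:
  fixes U V :: "'a \<Rightarrow> real"
  assumes U2: "integrable M (\<lambda>x. (U x)\<^sup>2)" and V2: "integrable M (\<lambda>x. (V x)\<^sup>2)"
    and UV: "integrable M (\<lambda>x. U x * V x)"
  shows "(\<integral>x. U x * V x \<partial>M) \<le> sqrt (\<integral>x. (U x)\<^sup>2 \<partial>M) * sqrt (\<integral>x. (V x)\<^sup>2 \<partial>M)"
proof -
  define \<alpha> \<beta> where "\<alpha> = sqrt (\<integral>x. (U x)\<^sup>2 \<partial>M)" and "\<beta> = sqrt (\<integral>x. (V x)\<^sup>2 \<partial>M)"
  have sq: "\<alpha>\<^sup>2 = (\<integral>x. (U x)\<^sup>2 \<partial>M)" "\<beta>\<^sup>2 = (\<integral>x. (V x)\<^sup>2 \<partial>M)"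
    unfolding \<alpha>_def \<beta>_def by simp_all
  have nonneg: "0 \<le> \<alpha>" "0 \<le> \<beta>" unfolding \<alpha>_def \<beta>_def by simp_all
  show ?thesis
  proof (cases "\<alpha> * \<beta> = 0")
    \<comment> \<open>The expansion is to be divided by \<open>\<alpha> * \<beta>\<close>. If that
      is 0, then \<open>U\<close> or \<open>V\<close> vanishes almost everywhere and both sides are
      0.\<close>
    case True
    have "AE x in M. U x * V x = 0"
    proof (cases "\<alpha> = 0")
      case True
      then have "AE x in M. (U x)\<^sup>2 = 0"
        using sq(1) integral_nonneg_eq_0_iff_AE[OF U2] by simp
      then show ?thesis by eventually_elim simp
    next
      case False
      then have "AE x in M. (V x)\<^sup>2 = 0"
        using True sq(2) integral_nonneg_eq_0_iff_AE[OF V2] by simp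
      then show ?thesis by eventually_elim simp
    qed
    then have "(\<integral>x. U x * V x \<partial>M) = 0"
      by (rule integral_eq_zero_AE)
    then show ?thesis using True unfolding \<alpha>_def \<beta>_def by simp
  next
    case False
    then have pos: "0 < \<alpha> * \<beta>" using nonneg by (simp add: less_le)
    have "0 \<le> (\<integral>x. (\<beta> * U x - \<alpha> * V x)\<^sup>2 \<partial>M)" by simp
    also have "\<dots> = (\<integral>x. \<beta>\<^sup>2 * (U x)\<^sup>2 + \<alpha>\<^sup>2 * (V x)\<^sup>2 - 2 * (\<alpha> * \<beta>) * (U x * V x) \<partial>M)"
      by (intro Bochner_Integration.integral_cong) (auto simp: power2_eq_square algebra_simps)
    also have "\<dots> = \<beta>\<^sup>2 * \<alpha>\<^sup>2 + \<alpha>\<^sup>2 * \<beta>\<^sup>2 - 2 * (\<alpha> * \<beta>) * (\<integral>x. U x * V x \<partial>M)"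
      using U2 V2 UV by (simp add: sq)
    finally have "(\<alpha> * \<beta>) * (\<integral>x. U x * V x \<partial>M) \<le> (\<alpha> * \<beta>) * (\<alpha> * \<beta>)"
      by (simp add: power2_eq_square algebra_simps)
    then show ?thesis using pos unfolding \<alpha>_def[symmetric] \<beta>_def[symmetric]
      by (simp only: mult_le_cancel_left_pos)
  qed
qed

section \<open>Concavity, the power budget and geometric decay\<close>

text \<open>Jensen with equal weights bounds the average of \<open>f\<close> by \<open>f\<close> at
  the average of \<open>y\<close>; monotonicity then moves that point up to
  \<open>m\<close>.\<close>

lemma concave_on_sum_le_card_mult_mean:
  fixes f :: "real \<Rightarrow> real" and y :: "'i \<Rightarrow> real" and m :: real
  assumes conc: "concave_on {0..} f" and mono: "mono_on {0..} f"
    and S: "finite S" "S \<noteq> {}" and y: "\<And>i. i \<in> S \<Longrightarrow> 0 \<le> y i"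
    and le: "sum y S \<le> card S * m"
  shows "(\<Sum>i\<in>S. f (y i)) \<le> card S * f m"
proof -
  have card: "0 < card S" using S by (simp add: card_gt_0_iff)
  have "(\<Sum>i\<in>S. (1 / card S) * f (y i)) \<le> f (\<Sum>i\<in>S. (1 / card S) *\<^sub>R y i)"
    by (rule concave_on_sum[OF S conc]) (use y card in auto)
  also have "(\<Sum>i\<in>S. (1 / card S) *\<^sub>R y i) = sum y S / card S"
    by (simp add: sum_divide_distrib)
  also have "f (sum y S / card S) \<le> f m"
  \<comment> \<open>\<open>m\<close> lies in the domain because it dominates an average of
    nonnegative numbers.\<close>
  proof (rule mono_onD[OF mono])
    have "0 \<le> sum y S / card S" using y by (simp add: sum_nonneg)
    moreover show "sum y S / card S \<le> m" using le card by (simp add: field_simps)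
    ultimately show "sum y S / card S \<in> {0..}" "m \<in> {0..}" by auto
  qed
  finally show ?thesis
    using card by (simp add: field_simps flip: sum_divide_distrib)
qed

text \<open>
  The additive offset \<open>\<kappa>\<close> perturbs the mean by \<open>\<kappa> / n\<close> only; continuity of \<open>f\<close> at \<open>m\<close>
  makes this harmless for long windows, and the finitely many short ones go into \<open>\<mu>\<close>.
\<close>

lemma geometric_bound_of_concave_weights:
  fixes f :: "real \<Rightarrow> real"
  assumes conc: "concave_on {0..} f" and mono: "mono_on {0..} f"
    and cont: "continuous_on {0..} f" and range: "f \<in> {0..} \<rightarrow> {0..1}"
    and nonneg: "0 \<le> \<beta>" "0 \<le> \<kappa>" "0 \<le> m" and "1 \<le> \<alpha>" "\<beta> \<le> \<alpha>"
    and contr: "(1 - f m) * \<beta> + f m * \<alpha> < 1"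
  obtains \<mu> c where "0 < \<mu>" "0 < c" "c < 1"
    "\<And>(S::nat set) y. finite S \<Longrightarrow> (\<And>i. i \<in> S \<Longrightarrow> 0 \<le> y i)
       \<Longrightarrow> sum y S \<le> \<kappa> + m * card S
       \<Longrightarrow> (\<Prod>i\<in>S. \<beta> + (\<alpha> - \<beta>) * f (y i)) \<le> \<mu> * c ^ card S"
proof -
  \<comment> \<open>If a step fails with probability \<open>f z\<close> and its squared growth
    factor is \<open>\<alpha>\<close> on failure and \<open>\<beta>\<close> on success,
    \<open>g z\<close> is the mean squared growth.\<close>
  define g where "g z = \<beta> + (\<alpha> - \<beta>) * f z" for z
  have gm: "g m < 1" using contr by (simp add: g_def algebra_simps)
  \<comment> \<open>The gap between \<open>g m\<close> and \<open>c\<close> absorbs the offset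
    \<open>\<kappa>\<close>; \<open>max 0\<close> keeps the rate positive even when
    \<open>g m = 0\<close>.\<close>
  obtain c where c: "max 0 (g m) < c" "c < 1"
    using dense[of "max 0 (g m)" 1] gm by auto
  have g_range: "0 \<le> g z" "g z \<le> \<alpha>" if "0 \<le> z" for z
  proof -
    have fz: "0 \<le> f z" "f z \<le> 1" using range that by auto
    show "0 \<le> g z" using fz nonneg \<open>\<beta> \<le> \<alpha>\<close> by (simp add: g_def)
    have "(\<alpha> - \<beta>) * f z \<le> \<alpha> - \<beta>" using fz \<open>\<beta> \<le> \<alpha>\<close> by (simp add: mult_left_le)
    then show "g z \<le> \<alpha>" by (simp add: g_def)
  qed
  have "(\<lambda>n. m + \<kappa> / real n) \<longlonglongrightarrow> m + 0"
    by (intro tendsto_intros lim_const_over_n)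
  then have "(\<lambda>n. g (m + \<kappa> / real n)) \<longlonglongrightarrow> g m"
    unfolding g_def using nonneg
    by (intro tendsto_intros continuous_on_tendsto_compose[OF cont]) auto
  then have "\<forall>\<^sub>F n in sequentially. g (m + \<kappa> / real n) < c"
    by (rule order_tendstoD) (use c in simp)
  then obtain n0 where n0: "\<And>n. n \<ge> n0 \<Longrightarrow> g (m + \<kappa> / real n) < c"
    unfolding eventually_sequentially by blast
  \<comment> \<open>On windows of at most \<open>n0\<close> steps each factor is bounded only by
    \<open>\<alpha>\<close>; this constant pays for replacing that power of \<open>\<alpha>\<close>
    by the same power of \<open>c\<close>.\<close>
  define \<mu> where "\<mu> = (\<alpha> / c) ^ (n0 + 1)"
  have ac: "1 \<le> \<alpha> / c" using c \<open>1 \<le> \<alpha>\<close> by (simp add: field_simps)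
  have \<mu>: "1 \<le> \<mu>" unfolding \<mu>_def using ac by (rule one_le_power)
  have cpos: "0 < c" using c by simp
  have "(\<Prod>i\<in>S. g (y i)) \<le> \<mu> * c ^ card S"
    if S: "finite S" and y: "\<And>i. i \<in> S \<Longrightarrow> 0 \<le> y i" and le: "sum y S \<le> \<kappa> + m * card S"
    for S :: "nat set" and y
  proof (cases "card S \<le> n0")
    case True
    have "(\<Prod>i\<in>S. g (y i)) \<le> (\<Prod>i\<in>S. \<alpha>)"
      using y g_range by (intro prod_mono) auto
    also have "\<dots> = (\<alpha> / c) ^ card S * c ^ card S"
      using cpos by (simp add: power_divide)
    also have "\<dots> \<le> \<mu> * c ^ card S"
      unfolding \<mu>_def using True ac cpos by (intro mult_right_mono power_increasing) auto
    finally show ?thesis .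
  next
    case False
    then have card: "0 < card S" and ne: "S \<noteq> {}" by auto
    let ?n = "card S"
    \<comment> \<open>The budget bounds the mean interference by \<open>m + \<kappa> / ?n\<close>.
      Jensen bounds the sum of the weights, and AM-GM passes from the sum to the product.\<close>
    have "sum y S \<le> ?n * (m + \<kappa> / ?n)" using le card by (simp add: distrib_left mult.commute)
    then have sumf: "(\<Sum>i\<in>S. f (y i)) \<le> ?n * f (m + \<kappa> / ?n)"
      by (intro concave_on_sum_le_card_mult_mean[OF conc mono S ne] y)
    have "(\<Sum>i\<in>S. g (y i)) = ?n * \<beta> + (\<alpha> - \<beta>) * (\<Sum>i\<in>S. f (y i))"
      by (simp add: g_def sum.distrib sum_distrib_left)
    also have "\<dots> \<le> ?n * \<beta> + (\<alpha> - \<beta>) * (?n * f (m + \<kappa> / ?n))"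
      using \<open>\<beta> \<le> \<alpha>\<close> sumf by (intro add_left_mono mult_left_mono) auto
    also have "\<dots> = ?n * g (m + \<kappa> / ?n)" by (simp add: g_def algebra_simps)
    also have "\<dots> \<le> ?n * c"
      using n0[of ?n] False by (intro mult_left_mono) auto
    finally have "(\<Prod>i\<in>S. g (y i)) \<le> c ^ ?n"
      using S y g_range cpos by (intro prod_le_power_of_sum_le) auto
    also have "\<dots> \<le> \<mu> * c ^ ?n" using \<mu> cpos by simp
    finally show ?thesis .
  qed
  then show thesis
    using that[of \<mu> c] \<mu> cpos c(2) unfolding g_def by auto
qed

section \<open>Averaging over the transmission randomness\<close>

text \<open>A uniform variable is at most \<open>z\<close> with probability \<open>z\<close>, so
  this is the mean of a two-point distribution with weights \<open>z\<close> and
  \<open>1 - z\<close>.\<close>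

lemma nn_integral_threshold_uniform:
  fixes \<alpha> \<beta> z :: real
  assumes X: "X \<in> borel_measurable M" "distr M borel X = uniform_measure lborel {0..1}"
    and "0 \<le> z" "z \<le> 1" "0 \<le> \<alpha>" "0 \<le> \<beta>"
  shows "(\<integral>\<^sup>+\<omega>. ennreal (if X \<omega> \<le> z then \<alpha> else \<beta>) \<partial>M) = ennreal (\<beta> + (\<alpha> - \<beta>) * z)"
proof -
  have "(\<integral>\<^sup>+\<omega>. ennreal (if X \<omega> \<le> z then \<alpha> else \<beta>) \<partial>M)
      = (\<integral>\<^sup>+x. ennreal (if x \<le> z then \<alpha> else \<beta>) \<partial>distr M borel X)"
    using X(1) by (subst nn_integral_distr) auto
  also have "\<dots> = (\<integral>\<^sup>+x. ennreal (if x \<le> z then \<alpha> else \<beta>) * indicator {0..1} x \<partial>lborel)"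
    unfolding X(2) by (subst nn_integral_uniform_measure) (auto simp: divide_ennreal_def)
  also have "\<dots> = (\<integral>\<^sup>+x. ennreal \<alpha> * indicator {0..z} x + ennreal \<beta> * indicator {z<..1} x \<partial>lborel)"
    using assms(3,4) by (intro nn_integral_cong) (auto simp: indicator_def)
  also have "\<dots> = ennreal \<alpha> * ennreal z + ennreal \<beta> * ennreal (1 - z)"
    using assms by (subst nn_integral_add) (auto simp: nn_integral_cmult)
  also have "\<dots> = ennreal (\<alpha> * z + \<beta> * (1 - z))"
    using assms by (simp flip: ennreal_mult'' ennreal_plus)
  finally show ?thesis by (simp add: algebra_simps)
qed

text \<open>Conditioning on the jamming path, done by Fubini: independence of the two processes
  makes their joint law a product, and for a frozen path the factors are independent with
  deterministic thresholds. The interference values may depend on each other arbitrarily.\<close>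

lemma (in prob_space) nn_integral_prod_threshold:
  fixes r \<phi> :: "nat \<Rightarrow> 'a \<Rightarrow> real" and p :: "real \<Rightarrow> real" and \<alpha> \<beta> :: real
  assumes p_range: "p \<in> {0..} \<rightarrow> {0..1}"
    and p_borel: "p \<in> borel_measurable (restrict_space borel {0..})"
    and r_indep: "indep_vars (\<lambda>_. borel) r UNIV"
    and r_uniform: "\<And>t. distr M borel (r t) = uniform_measure lborel {0..1}"
    and \<phi>_nonneg: "\<And>t \<omega>. \<omega> \<in> space M \<Longrightarrow> 0 \<le> \<phi> t \<omega>"
    and r_\<phi>_indep: "indep_var
          (PiM UNIV (\<lambda>_. borel)) (\<lambda>\<omega> t. r t \<omega>)
          (PiM UNIV (\<lambda>_. borel)) (\<lambda>\<omega> t. \<phi> t \<omega>)"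
    and "finite S" "0 \<le> \<alpha>" "0 \<le> \<beta>"
  shows "(\<integral>\<^sup>+\<omega>. (\<Prod>i\<in>S. ennreal (if r i \<omega> \<le> p (\<phi> i \<omega>) then \<alpha> else \<beta>)) \<partial>M)
    = (\<integral>\<^sup>+\<omega>. (\<Prod>i\<in>S. ennreal (\<beta> + (\<alpha> - \<beta>) * p (\<phi> i \<omega>))) \<partial>M)"
proof -
  \<comment> \<open>The path law lives on all real sequences, while \<open>p\<close> is controlled
    only on the nonnegative reals; \<open>q\<close> is a Borel extension that agrees with
    \<open>p\<close> along \<open>\<phi>\<close>.\<close>
  define q where "q y = p (max 0 y)" for y
  have "(\<lambda>y::real. max 0 y) \<in> borel \<rightarrow>\<^sub>M restrict_space borel {0..}"
    by (intro measurable_restrict_space2) auto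
  from measurable_compose[OF this p_borel] have q_meas [measurable]: "q \<in> borel_measurable borel"
    unfolding q_def .
  have q_range: "0 \<le> q y" "q y \<le> 1" for y
    using p_range unfolding q_def by (auto simp: Pi_iff)
  have q_\<phi>: "q (\<phi> i \<omega>) = p (\<phi> i \<omega>)" if "\<omega> \<in> space M" for i \<omega>
    using \<phi>_nonneg[OF that] by (simp add: q_def)
  define \<Omega> :: "(nat \<Rightarrow> real) measure" where "\<Omega> = PiM UNIV (\<lambda>_. borel)"
  define R where "R = distr M \<Omega> (\<lambda>\<omega> t. r t \<omega>)"
  define P where "P = distr M \<Omega> (\<lambda>\<omega> t. \<phi> t \<omega>)"
  have rv [measurable]: "(\<lambda>\<omega> t. r t \<omega>) \<in> M \<rightarrow>\<^sub>M \<Omega>" "(\<lambda>\<omega> t. \<phi> t \<omega>) \<in> M \<rightarrow>\<^sub>M \<Omega>"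
    and joint: "R \<Otimes>\<^sub>M P = distr M (\<Omega> \<Otimes>\<^sub>M \<Omega>) (\<lambda>\<omega>. (\<lambda>t. r t \<omega>, \<lambda>t. \<phi> t \<omega>))"
    using r_\<phi>_indep unfolding indep_var_distribution_eq R_def P_def \<Omega>_def by auto
  interpret R: prob_space R unfolding R_def by (rule prob_space_distr) (rule rv)
  interpret P: prob_space P unfolding P_def by (rule prob_space_distr) (rule rv)
  interpret RP: pair_sigma_finite R P ..
  have r_meas [measurable]: "r i \<in> borel_measurable M" for i
    using r_indep unfolding indep_vars_def by auto
  define h where "h z y = ennreal (if z \<le> q y then \<alpha> else \<beta>)" for z y
  have coord [measurable]: "(\<lambda>\<rho>. \<rho> i) \<in> borel_measurable \<Omega>" for i
    unfolding \<Omega>_def by measurable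
  have hr_meas [measurable]: "(\<lambda>z. h z y) \<in> borel_measurable borel" for y
    unfolding h_def by measurable
  define G where "G \<rho> y = (\<Prod>i\<in>S. h (\<rho> i) (y i))" for \<rho> y
  have G_meas: "(\<lambda>(\<rho>, y). G \<rho> y) \<in> borel_measurable (\<Omega> \<Otimes>\<^sub>M \<Omega>)"
    unfolding G_def h_def split_beta by measurable
  have G_meas1: "(\<lambda>\<rho>. G \<rho> y) \<in> borel_measurable \<Omega>" for y
    unfolding G_def h_def by measurable
  have sets_RP: "sets (R \<Otimes>\<^sub>M P) = sets (\<Omega> \<Otimes>\<^sub>M \<Omega>)"
    unfolding joint by simp
  \<comment> \<open>With the jamming path frozen at \<open>y\<close>, independence over time factors
    the integral.\<close>
  have inner: "(\<integral>\<^sup>+\<rho>. G \<rho> y \<partial>R) = (\<Prod>i\<in>S. ennreal (\<beta> + (\<alpha> - \<beta>) * q (y i)))" for y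
  proof -
    have "indep_vars (\<lambda>_. borel) r S"
      using r_indep by (rule indep_vars_subset) simp
    then have indep: "indep_vars (\<lambda>_. borel) (\<lambda>i \<omega>. h (r i \<omega>) (y i)) S"
      by (rule indep_vars_compose2) measurable
    have "(\<integral>\<^sup>+\<rho>. G \<rho> y \<partial>R) = (\<integral>\<^sup>+\<omega>. (\<Prod>i\<in>S. h (r i \<omega>) (y i)) \<partial>M)"
      unfolding R_def using G_meas1 by (subst nn_integral_distr) (auto simp: G_def)
    also have "\<dots> = (\<Prod>i\<in>S. \<integral>\<^sup>+\<omega>. h (r i \<omega>) (y i) \<partial>M)"
      by (intro indep_vars_nn_integral indep \<open>finite S\<close>) simp
    also have "\<dots> = (\<Prod>i\<in>S. ennreal (\<beta> + (\<alpha> - \<beta>) * q (y i)))"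
      unfolding h_def using q_range assms
      by (intro prod.cong refl nn_integral_threshold_uniform) auto
    finally show ?thesis .
  qed
  have "(\<integral>\<^sup>+\<omega>. (\<Prod>i\<in>S. ennreal (if r i \<omega> \<le> p (\<phi> i \<omega>) then \<alpha> else \<beta>)) \<partial>M)
      = (\<integral>\<^sup>+\<omega>. G (\<lambda>t. r t \<omega>) (\<lambda>t. \<phi> t \<omega>) \<partial>M)"
    by (intro nn_integral_cong) (simp add: G_def h_def q_\<phi>)
  also have "\<dots> = (\<integral>\<^sup>+x. (case x of (\<rho>, y) \<Rightarrow> G \<rho> y) \<partial>(R \<Otimes>\<^sub>M P))"
    unfolding joint using G_meas by (subst nn_integral_distr) auto
  \<comment> \<open>The path of \<open>r\<close> is integrated first, so the jamming path stays
    fixed in the inner integral.\<close>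
  also have "\<dots> = (\<integral>\<^sup>+y. (\<integral>\<^sup>+\<rho>. G \<rho> y \<partial>R) \<partial>P)"
    using G_meas by (subst RP.nn_integral_snd[symmetric]) (auto simp: measurable_cong_sets[OF sets_RP refl])
  also have "\<dots> = (\<integral>\<^sup>+y. (\<Prod>i\<in>S. ennreal (\<beta> + (\<alpha> - \<beta>) * q (y i))) \<partial>P)"
    unfolding inner ..
  also have "\<dots> = (\<integral>\<^sup>+\<omega>. (\<Prod>i\<in>S. ennreal (\<beta> + (\<alpha> - \<beta>) * q (\<phi> i \<omega>))) \<partial>M)"
    unfolding P_def by (subst nn_integral_distr) measurable
  also have "\<dots> = (\<integral>\<^sup>+\<omega>. (\<Prod>i\<in>S. ennreal (\<beta> + (\<alpha> - \<beta>) * p (\<phi> i \<omega>))) \<partial>M)"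
    by (intro nn_integral_cong) (simp add: q_\<phi>)
  finally show ?thesis .
qed

section \<open>Trajectories of the closed loop\<close>

text \<open>Variation of constants along a single path. On success the two linear terms merge into
  \<open>A + B ** K\<close>. The disturbance \<open>w i\<close> first appears in state
  \<open>i + 1\<close>, so its product starts at \<open>Suc i\<close>.\<close>

lemma closed_loop_state_norm_le:
  fixes A :: "real^'n^'n" and B :: "real^'m^'n" and K :: "real^'n^'m"
    and l :: "nat \<Rightarrow> 'a \<Rightarrow> real"
  assumes N: "is_vector_norm N" and l: "\<And>s. l s \<omega> \<in> {0, 1}"
  defines "\<gamma> s \<equiv> if l s \<omega> = 1 then induced_matrix_norm N A else induced_matrix_norm N (A + B ** K)"
  shows "N (closed_loop_state A B K l w x0 t \<omega>)
    \<le> (\<Prod>s\<in>{0..<t}. \<gamma> s) * N x0 + (\<Sum>i<t. (\<Prod>s\<in>{Suc i..<t}. \<gamma> s) * N (w i \<omega>))"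
proof (induction t)
  case 0
  then show ?case by simp
next
  case (Suc t)
  let ?x = "closed_loop_state A B K l w x0 t \<omega>"
  have \<gamma>0: "0 \<le> \<gamma> s" for s using induced_matrix_norm_nonneg[OF N] by (simp add: \<gamma>_def)
  have step: "N (A *v ?x + (1 - l t \<omega>) *\<^sub>R (B *v (K *v ?x))) \<le> \<gamma> t * N ?x"
  proof (cases "l t \<omega> = 1")
    case True
    then show ?thesis using induced_matrix_norm_bound[OF N, of A ?x] by (simp add: \<gamma>_def)
  next
    case False
    then have "l t \<omega> = 0" using l[of t] by auto
    then show ?thesis using induced_matrix_norm_bound[OF N, of "A + B ** K" ?x]
      by (simp add: \<gamma>_def matrix_vector_mult_add_rdistrib matrix_vector_mul_assoc)
  qed
  have "N (closed_loop_state A B K l w x0 (Suc t) \<omega>)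
      \<le> N (A *v ?x + (1 - l t \<omega>) *\<^sub>R (B *v (K *v ?x))) + N (w t \<omega>)"
    using N unfolding is_vector_norm_def by simp
  also have "\<dots> \<le> \<gamma> t * N ?x + N (w t \<omega>)" using step by simp
  also have "\<dots> \<le> \<gamma> t * ((\<Prod>s\<in>{0..<t}. \<gamma> s) * N x0
      + (\<Sum>i<t. (\<Prod>s\<in>{Suc i..<t}. \<gamma> s) * N (w i \<omega>))) + N (w t \<omega>)"
    using mult_left_mono[OF Suc.IH \<gamma>0] by simp
  also have "\<dots> = (\<Prod>s\<in>{0..<Suc t}. \<gamma> s) * N x0
      + (\<Sum>i<Suc t. (\<Prod>s\<in>{Suc i..<Suc t}. \<gamma> s) * N (w i \<omega>))"
    by (simp add: distrib_left sum_distrib_left mult_ac)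
  finally show ?case .
qed

lemma borel_measurable_matrix_vector_mult [measurable (raw)]:
  fixes D :: "real^'n^'m"
  assumes "f \<in> borel_measurable M"
  shows "(\<lambda>x. D *v f x) \<in> borel_measurable M"
  by (rule borel_measurable_continuous_on[OF _ assms])
    (intro linear_continuous_on matrix_vector_mul_bounded_linear)

lemma closed_loop_state_measurable:
  assumes l: "\<And>t. l t \<in> borel_measurable M" and w: "\<And>t. w t \<in> borel_measurable M"
  shows "closed_loop_state A B K l w x0 t \<in> borel_measurable M"
proof (induction t)
  case 0
  then show ?case by (simp add: fun_eq_iff cong: measurable_cong)
next
  case (Suc t)
  note [measurable] = Suc l w
  have "(\<lambda>\<omega>. A *v closed_loop_state A B K l w x0 t \<omega>
      + (1 - l t \<omega>) *\<^sub>R (B *v (K *v closed_loop_state A B K l w x0 t \<omega>)) + w t \<omega>)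
    \<in> borel_measurable M"
    by measurable
  then show ?case by (simp cong: measurable_cong)
qed

lemma sum_power_reverse_le:
  fixes \<theta> :: real
  assumes "0 \<le> \<theta>" "\<theta> < 1"
  shows "(\<Sum>i<t. \<theta> ^ (t - Suc i)) \<le> 1 / (1 - \<theta>)"
proof -
  have "(\<Sum>i<t. \<theta> ^ (t - Suc i)) = (\<Sum>i<t. \<theta> ^ i)"
    by (rule sum.nat_diff_reindex)
  also have "\<dots> = (1 - \<theta> ^ t) / (1 - \<theta>)"
    using assms by (simp add: sum_gp_strict)
  also have "\<dots> \<le> 1 / (1 - \<theta>)" using assms by (intro divide_right_mono) auto
  finally show ?thesis .
qed

section \<open>The bound on the mean state norm\<close>

text \<open>Integrability is asserted beside the bound because the Bochner integral of a
  nonintegrable function is 0, which would make the bound meaningless.\<close>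

theorem mainTheorem2:
  fixes M :: "'a measure"
    and A :: "real^'n^'n" and B :: "real^'m^'n" and K :: "real^'n^'m"
    and p p_hat :: "real \<Rightarrow> real"
    and r \<phi> :: "nat \<Rightarrow> 'a \<Rightarrow> real"
    and w :: "nat \<Rightarrow> 'a \<Rightarrow> real^'n"
    and N :: "real^'n \<Rightarrow> real"
    and \<kappa>_hat \<phi>_hat :: real
  assumes prob: "prob_space M"
    and A_unstable: "unstable A"
    and N_norm: "is_vector_norm N"
    and p_range: "p \<in> {0..} \<rightarrow> {0..1}"
    and p_borel: "p \<in> borel_measurable (restrict_space borel {0..})"
    and p_mono: "mono_on {0..} p"
    and p_hat_range: "p_hat \<in> {0..} \<rightarrow> {0..1}"
    and p_hat_cont: "continuous_on {0..} p_hat"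
    and p_hat_mono: "mono_on {0..} p_hat"
    and p_hat_concave: "concave_on {0..} p_hat"
    and p_le_p_hat: "\<And>y. 0 \<le> y \<Longrightarrow> p y \<le> p_hat y"
    and r_indep: "prob_space.indep_vars M (\<lambda>_. borel) r UNIV"
    and r_uniform: "\<And>t. distr M borel (r t) = uniform_measure lborel {0..1}"
    and \<phi>_meas: "\<And>t. \<phi> t \<in> borel_measurable M"
    and \<phi>_nonneg: "\<And>t \<omega>. \<omega> \<in> space M \<Longrightarrow> 0 \<le> \<phi> t \<omega>"
    and r_\<phi>_indep: "prob_space.indep_var M
          (PiM UNIV (\<lambda>_. borel)) (\<lambda>\<omega> t. r t \<omega>)
          (PiM UNIV (\<lambda>_. borel)) (\<lambda>\<omega> t. \<phi> t \<omega>)"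
    and w_meas: "\<And>t. w t \<in> borel_measurable M"
    and \<kappa>_hat_nonneg: "0 \<le> \<kappa>_hat"
    and \<phi>_hat_nonneg: "0 \<le> \<phi>_hat"
    and jamming_bound: "\<And>t1 t2. t1 < t2 \<Longrightarrow>
          \<P>(\<omega> in M. (\<Sum>i=t1..<t2. \<phi> i \<omega>) \<le> \<kappa>_hat + \<phi>_hat * real (t2 - t1)) = 1"
    and w_second_moment: "\<And>t. integrable M (\<lambda>\<omega>. (norm (w t \<omega>))\<^sup>2)"
    and contraction: "(1 - p_hat \<phi>_hat) * (induced_matrix_norm N (A + B ** K))\<^sup>2
          + p_hat \<phi>_hat * (induced_matrix_norm N A)\<^sup>2 < 1"
  shows "\<exists>\<mu> f \<theta>. 0 \<le> \<mu> \<and> 0 \<le> f \<and> 0 < \<theta> \<and> \<theta> < 1 \<and>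
    (\<forall>x0. \<forall>t\<ge>1.
      let x = closed_loop_state A B K (failure_indicator p r \<phi>) w x0 in
      integrable M (\<lambda>\<omega>. norm (x t \<omega>)) \<and>
      (\<integral>\<omega>. norm (x t \<omega>) \<partial>M) \<le> \<mu> * \<theta> ^ t * norm x0
        + f * (MAX i\<in>{0..t-1}. sqrt (\<integral>\<omega>. (norm (w i \<omega>))\<^sup>2 \<partial>M)))"
proof -
  interpret prob_space M by (rule prob)
  define a b where "a = induced_matrix_norm N A" and "b = induced_matrix_norm N (A + B ** K)"
  have a1: "1 < a" unfolding a_def by (rule unstable_imp_induced_matrix_norm_gt_1[OF N_norm A_unstable])
  have b0: "0 \<le> b" unfolding b_def by (rule induced_matrix_norm_nonneg[OF N_norm])
  have ph: "0 \<le> p_hat \<phi>_hat" "p_hat \<phi>_hat \<le> 1"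
    using p_hat_range \<phi>_hat_nonneg by auto
  have a2: "1 < a\<^sup>2" using a1 by (simp add: one_less_power)
  have contr: "(1 - p_hat \<phi>_hat) * b\<^sup>2 + p_hat \<phi>_hat * a\<^sup>2 < 1"
    using contraction unfolding a_def b_def .
  \<comment> \<open>Otherwise both squares exceed 1, and so their convex combination in
    \<open>contr\<close> could not be below 1.\<close>
  have ba2: "b\<^sup>2 \<le> a\<^sup>2"
  proof (rule ccontr)
    assume "\<not> ?thesis"
    then have "(1 - p_hat \<phi>_hat) * 1 \<le> (1 - p_hat \<phi>_hat) * b\<^sup>2"
      using a2 ph by (intro mult_left_mono) auto
    moreover have "p_hat \<phi>_hat * 1 \<le> p_hat \<phi>_hat * a\<^sup>2"
      using a2 ph by (intro mult_left_mono) auto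
    ultimately show False using contr by (simp add: algebra_simps)
  qed
  have ba: "b \<le> a" using power2_le_imp_le[OF ba2] a1 by linarith
  obtain \<mu> c where \<mu>c: "0 < \<mu>" "0 < c" "c < 1" and geom:
    "\<And>(S::nat set) y. finite S \<Longrightarrow> (\<And>i. i \<in> S \<Longrightarrow> 0 \<le> y i)
       \<Longrightarrow> sum y S \<le> \<kappa>_hat + \<phi>_hat * card S
       \<Longrightarrow> (\<Prod>i\<in>S. b\<^sup>2 + (a\<^sup>2 - b\<^sup>2) * p_hat (y i)) \<le> \<mu> * c ^ card S"
    using geometric_bound_of_concave_weights[OF p_hat_concave p_hat_mono p_hat_cont p_hat_range
        zero_le_power2 \<kappa>_hat_nonneg \<phi>_hat_nonneg less_imp_le[OF a2] ba2 contr] by metis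
  \<comment> \<open>\<open>c\<close> is the decay rate of second moments; Cauchy-Schwarz passes to
    first moments at the price of a square root.\<close>
  define \<theta> where "\<theta> = sqrt c"
  have \<theta>: "0 < \<theta>" "\<theta> < 1" using \<mu>c by (auto simp: \<theta>_def)
  note [measurable] = \<phi>_meas w_meas
  have r_meas [measurable]: "r i \<in> borel_measurable M" for i
    using r_indep unfolding indep_vars_def by auto
  have p\<phi>_meas [measurable]: "(\<lambda>\<omega>. p (\<phi> i \<omega>)) \<in> borel_measurable M" for i
  proof -
    have "\<phi> i \<in> M \<rightarrow>\<^sub>M restrict_space borel {0..}"
      using \<phi>_nonneg by (intro measurable_restrict_space2) auto
    from measurable_compose[OF this p_borel] show ?thesis .
  qed
  have l_meas: "failure_indicator p r \<phi> i \<in> borel_measurable M" for i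
    unfolding failure_indicator_def[abs_def] by measurable
  define \<gamma> where "\<gamma> s \<omega> = (if r s \<omega> \<le> p (\<phi> s \<omega>) then a else b)" for s \<omega>
  have \<gamma>_meas [measurable]: "\<gamma> s \<in> borel_measurable M" for s
    unfolding \<gamma>_def[abs_def] by measurable
  \<comment> \<open>The amplification over the steps from \<open>i\<close> to \<open>t - 1\<close>,
    equal to 1 on an empty window.\<close>
  define G where "G i t \<omega> = (\<Prod>s\<in>{i..<t}. \<gamma> s \<omega>)" for i t \<omega>
  have G_meas [measurable]: "G i t \<in> borel_measurable M" for i t
    unfolding G_def[abs_def] by measurable
  have G0: "0 \<le> G i t \<omega>" for i t \<omega>
    unfolding G_def \<gamma>_def using a1 b0 by (intro prod_nonneg) auto
  \<comment> \<open>This crude deterministic bound serves integrability only; decay comes from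
    \<open>G2\<close>.\<close>
  have G_le: "G i t \<omega> \<le> a ^ (t - i)" for i t \<omega>
  proof -
    have "G i t \<omega> \<le> (\<Prod>s\<in>{i..<t}. a)"
      unfolding G_def \<gamma>_def using a1 b0 ba by (intro prod_mono) auto
    then show ?thesis by simp
  qed
  have G2_int: "integrable M (\<lambda>\<omega>. (G i t \<omega>)\<^sup>2)" for i t
    by (rule integrable_const_bound[where B = "(a ^ (t - i))\<^sup>2"])
      (auto intro!: power_mono G_le G0)
  have G2: "(\<integral>\<omega>. (G i t \<omega>)\<^sup>2 \<partial>M) \<le> \<mu> * c ^ (t - i)" for i t
  proof -
    \<comment> \<open>The exceptional null set may depend on the window, which is fixed here. For an
      empty window the claim is \<open>0 \<le> \<kappa>_hat\<close>.\<close>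
    have budget: "AE \<omega> in M. sum (\<lambda>s. \<phi> s \<omega>) {i..<t} \<le> \<kappa>_hat + \<phi>_hat * card {i..<t}"
    proof (cases "i < t")
      case True
      have "{\<omega> \<in> space M. (\<Sum>s=i..<t. \<phi> s \<omega>) \<le> \<kappa>_hat + \<phi>_hat * real (t - i)} \<in> sets M"
        by measurable
      from prob_Collect_eq_1[OF this] jamming_bound[OF True] show ?thesis by simp
    qed (use \<kappa>_hat_nonneg in simp)
    have "ennreal (\<integral>\<omega>. (G i t \<omega>)\<^sup>2 \<partial>M) = (\<integral>\<^sup>+\<omega>. ennreal ((G i t \<omega>)\<^sup>2) \<partial>M)"
      using G2_int by (simp add: nn_integral_eq_integral)
    also have "\<dots> = (\<integral>\<^sup>+\<omega>. (\<Prod>s\<in>{i..<t}. ennreal (if r s \<omega> \<le> p (\<phi> s \<omega>) then a\<^sup>2 else b\<^sup>2)) \<partial>M)"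
      by (intro nn_integral_cong)
        (auto simp: G_def \<gamma>_def prod_ennreal prod_power_distrib intro!: arg_cong[of _ _ ennreal] prod.cong)
    also have "\<dots> = (\<integral>\<^sup>+\<omega>. (\<Prod>s\<in>{i..<t}. ennreal (b\<^sup>2 + (a\<^sup>2 - b\<^sup>2) * p (\<phi> s \<omega>))) \<partial>M)"
      by (rule nn_integral_prod_threshold[OF p_range p_borel r_indep r_uniform \<phi>_nonneg r_\<phi>_indep]) auto
    also have "\<dots> \<le> (\<integral>\<^sup>+\<omega>. ennreal (\<mu> * c ^ (t - i)) \<partial>M)"
    proof (rule nn_integral_mono_AE, use budget AE_space in eventually_elim)
      fix \<omega> assume \<omega>: "\<omega> \<in> space M"
        and le: "sum (\<lambda>s. \<phi> s \<omega>) {i..<t} \<le> \<kappa>_hat + \<phi>_hat * card {i..<t}"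
      have nn: "0 \<le> b\<^sup>2 + (a\<^sup>2 - b\<^sup>2) * p (\<phi> s \<omega>)" for s
        using p_range \<phi>_nonneg[OF \<omega>, of s] ba2 by (auto simp: Pi_iff)
      have "(\<Prod>s\<in>{i..<t}. ennreal (b\<^sup>2 + (a\<^sup>2 - b\<^sup>2) * p (\<phi> s \<omega>)))
          = ennreal (\<Prod>s\<in>{i..<t}. b\<^sup>2 + (a\<^sup>2 - b\<^sup>2) * p (\<phi> s \<omega>))"
        using nn by (intro prod_ennreal)
      \<comment> \<open>Passing from \<open>p\<close> to its concave majorant enlarges every weight
        because \<open>b\<^sup>2 \<le> a\<^sup>2\<close>.\<close>
      also have "\<dots> \<le> ennreal (\<Prod>s\<in>{i..<t}. b\<^sup>2 + (a\<^sup>2 - b\<^sup>2) * p_hat (\<phi> s \<omega>))"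
        using nn p_le_p_hat \<phi>_nonneg[OF \<omega>] ba2
        by (intro ennreal_leI prod_mono conjI add_left_mono mult_left_mono) auto
      also have "\<dots> \<le> ennreal (\<mu> * c ^ (t - i))"
        using geom[of "{i..<t}" "\<lambda>s. \<phi> s \<omega>"] le \<phi>_nonneg[OF \<omega>] by (intro ennreal_leI) simp
      finally show "(\<Prod>s\<in>{i..<t}. ennreal (b\<^sup>2 + (a\<^sup>2 - b\<^sup>2) * p (\<phi> s \<omega>)))
          \<le> ennreal (\<mu> * c ^ (t - i))" .
    qed
    also have "\<dots> = ennreal (\<mu> * c ^ (t - i))" by (simp add: emeasure_space_1)
    finally show ?thesis using \<mu>c by (simp add: ennreal_le_iff)
  qed
  have G_rms: "sqrt (\<integral>\<omega>. (G i t \<omega>)\<^sup>2 \<partial>M) \<le> sqrt \<mu> * \<theta> ^ (t - i)" for i t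
    using real_sqrt_le_mono[OF G2[of i t]] by (simp add: real_sqrt_mult real_sqrt_power \<theta>_def)
  have Gv_int: "integrable M (\<lambda>\<omega>. G i t \<omega> * v \<omega>)"
    if v: "integrable M v" for i t and v :: "'a \<Rightarrow> real"
  proof (rule Bochner_Integration.integrable_bound)
    show "integrable M (\<lambda>\<omega>. a ^ (t - i) * v \<omega>)" using v by simp
    have [measurable]: "v \<in> borel_measurable M" using v by simp
    show "(\<lambda>\<omega>. G i t \<omega> * v \<omega>) \<in> borel_measurable M" by measurable
    show "AE \<omega> in M. norm (G i t \<omega> * v \<omega>) \<le> norm (a ^ (t - i) * v \<omega>)"
      using G0 G_le a1 by (auto simp: abs_mult intro!: mult_right_mono)
  qed
  \<comment> \<open>Cauchy-Schwarz needs no independence of \<open>G\<close> and \<open>v\<close>,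
    so \<open>v\<close> may be the norm of a disturbance that depends on the failures.\<close>
  have Gv_le: "(\<integral>\<omega>. G i t \<omega> * v \<omega> \<partial>M) \<le> sqrt \<mu> * \<theta> ^ (t - i) * sqrt (\<integral>\<omega>. (v \<omega>)\<^sup>2 \<partial>M)"
    if v: "v \<in> borel_measurable M" "integrable M (\<lambda>\<omega>. (v \<omega>)\<^sup>2)" for i t and v :: "'a \<Rightarrow> real"
  proof -
    have "(\<integral>\<omega>. G i t \<omega> * v \<omega> \<partial>M)
        \<le> sqrt (\<integral>\<omega>. (G i t \<omega>)\<^sup>2 \<partial>M) * sqrt (\<integral>\<omega>. (v \<omega>)\<^sup>2 \<partial>M)"
      by (intro integral_mult_le_sqrt_integral_squares G2_int v Gv_int square_integrable_imp_integrable)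
    also have "\<dots> \<le> sqrt \<mu> * \<theta> ^ (t - i) * sqrt (\<integral>\<omega>. (v \<omega>)\<^sup>2 \<partial>M)"
      by (intro mult_right_mono G_rms) simp
    finally show ?thesis .
  qed
  have w_int: "integrable M (\<lambda>\<omega>. norm (w i \<omega>))" for i
    by (rule square_integrable_imp_integrable[OF _ w_second_moment]) measurable
  obtain d D where dD: "0 < d" "0 < D" "\<And>x. d * norm x \<le> N x" "\<And>x. N x \<le> D * norm x"
    using is_vector_norm_equiv[OF N_norm] by blast
  let ?x = "closed_loop_state A B K (failure_indicator p r \<phi>) w"
  \<comment> \<open>\<open>D\<close> comes from estimating \<open>N\<close> of the initial state and
    of the disturbances, \<open>1 / d\<close> from returning to the Euclidean norm of the
    state.\<close>
  define bnd where "bnd x0 t \<omega> = (D / d) * (G 0 t \<omega> * norm x0 + (\<Sum>i<t. G (Suc i) t \<omega> * norm (w i \<omega>)))"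
    for x0 :: "real^'n" and t \<omega>
  have x_le: "norm (?x x0 t \<omega>) \<le> bnd x0 t \<omega>" for x0 t \<omega>
  proof -
    have "N (?x x0 t \<omega>) \<le> G 0 t \<omega> * N x0 + (\<Sum>i<t. G (Suc i) t \<omega> * N (w i \<omega>))"
      using closed_loop_state_norm_le[OF N_norm, of "failure_indicator p r \<phi>" \<omega> A B K w x0 t]
      unfolding G_def \<gamma>_def a_def b_def by (simp add: failure_indicator_def)
    also have "\<dots> \<le> G 0 t \<omega> * (D * norm x0) + (\<Sum>i<t. G (Suc i) t \<omega> * (D * norm (w i \<omega>)))"
      by (intro add_mono sum_mono mult_left_mono G0 dD)
    also have "\<dots> = d * bnd x0 t \<omega>"
      using dD by (simp add: bnd_def distrib_left sum_distrib_left mult_ac)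
    finally have "d * norm (?x x0 t \<omega>) \<le> d * bnd x0 t \<omega>" using dD(3)[of "?x x0 t \<omega>"] by linarith
    then show ?thesis using dD by simp
  qed
  have bnd_int: "integrable M (bnd x0 t)" for x0 t
    unfolding bnd_def[abs_def]
    by (intro integrable_mult_right Bochner_Integration.integrable_add
        Bochner_Integration.integrable_sum Gv_int w_int) simp
  have x_int: "integrable M (\<lambda>\<omega>. norm (?x x0 t \<omega>))" for x0 t
  proof (rule Bochner_Integration.integrable_bound[OF bnd_int[of x0 t]])
    show "(\<lambda>\<omega>. norm (?x x0 t \<omega>)) \<in> borel_measurable M"
      by (intro measurable_compose[OF _ borel_measurable_norm] closed_loop_state_measurable
          l_meas w_meas)
    show "AE \<omega> in M. norm (norm (?x x0 t \<omega>)) \<le> norm (bnd x0 t \<omega>)"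
      by (intro AE_I2) (simp add: order_trans[OF x_le abs_ge_self])
  qed
  have main: "(\<integral>\<omega>. norm (?x x0 t \<omega>) \<partial>M) \<le> (D / d * sqrt \<mu>) * \<theta> ^ t * norm x0
      + (D / d * sqrt \<mu> / (1 - \<theta>)) * (MAX i\<in>{0..t-1}. sqrt (\<integral>\<omega>. (norm (w i \<omega>))\<^sup>2 \<partial>M))"
    if "1 \<le> t" for x0 t
  proof -
    define W where "W = (MAX i\<in>{0..t-1}. sqrt (\<integral>\<omega>. (norm (w i \<omega>))\<^sup>2 \<partial>M))"
    have W: "sqrt (\<integral>\<omega>. (norm (w i \<omega>))\<^sup>2 \<partial>M) \<le> W" if "i < t" for i
      unfolding W_def using that by (intro Max_ge) auto
    \<comment> \<open>As \<open>1 \<le> t\<close>, index 0 is among those of the maximum, so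
      \<open>W\<close> dominates a nonnegative number.\<close>
    have "0 \<le> sqrt (\<integral>\<omega>. (norm (w 0 \<omega>))\<^sup>2 \<partial>M)" by simp
    with W[of 0] that have W0: "0 \<le> W" by linarith
    have "(\<integral>\<omega>. norm (?x x0 t \<omega>) \<partial>M) \<le> (\<integral>\<omega>. bnd x0 t \<omega> \<partial>M)"
      by (intro integral_mono x_int bnd_int x_le)
    also have "\<dots> = D / d * ((\<integral>\<omega>. G 0 t \<omega> * norm x0 \<partial>M)
        + (\<Sum>i<t. \<integral>\<omega>. G (Suc i) t \<omega> * norm (w i \<omega>) \<partial>M))"
      unfolding bnd_def using Gv_int w_int
      by (simp only: integral_mult_right_zero Bochner_Integration.integral_add
          Bochner_Integration.integral_sum Bochner_Integration.integrable_sum integrable_const)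
    also have "\<dots> \<le> D / d * (sqrt \<mu> * \<theta> ^ t * norm x0 + (\<Sum>i<t. sqrt \<mu> * \<theta> ^ (t - Suc i) * W))"
    proof (intro mult_left_mono add_mono sum_mono)
      \<comment> \<open>The constant \<open>norm x0\<close> is treated as a random variable whose
        root mean square is itself.\<close>
      show "(\<integral>\<omega>. G 0 t \<omega> * norm x0 \<partial>M) \<le> sqrt \<mu> * \<theta> ^ t * norm x0"
        using Gv_le[of "\<lambda>_. norm x0" 0 t] by (simp add: prob_space)
      fix i assume "i \<in> {..<t}"
      have "(\<integral>\<omega>. G (Suc i) t \<omega> * norm (w i \<omega>) \<partial>M)
          \<le> sqrt \<mu> * \<theta> ^ (t - Suc i) * sqrt (\<integral>\<omega>. (norm (w i \<omega>))\<^sup>2 \<partial>M)"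
        by (intro Gv_le w_second_moment) measurable
      also have "\<dots> \<le> sqrt \<mu> * \<theta> ^ (t - Suc i) * W"
        using \<open>i \<in> {..<t}\<close> \<theta> \<mu>c by (intro mult_left_mono W) auto
      finally show "(\<integral>\<omega>. G (Suc i) t \<omega> * norm (w i \<omega>) \<partial>M) \<le> sqrt \<mu> * \<theta> ^ (t - Suc i) * W" .
    qed (use dD in simp)
    also have "(\<Sum>i<t. sqrt \<mu> * \<theta> ^ (t - Suc i) * W) = sqrt \<mu> * W * (\<Sum>i<t. \<theta> ^ (t - Suc i))"
      by (simp add: sum_distrib_left mult_ac)
    \<comment> \<open>The geometric series bounds the accumulated disturbances uniformly in
      \<open>t\<close>, which gives the factor \<open>1 / (1 - \<theta>)\<close> in the disturbance
      gain.\<close>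
    also have "D / d * (sqrt \<mu> * \<theta> ^ t * norm x0 + sqrt \<mu> * W * (\<Sum>i<t. \<theta> ^ (t - Suc i)))
        \<le> D / d * (sqrt \<mu> * \<theta> ^ t * norm x0 + sqrt \<mu> * W * (1 / (1 - \<theta>)))"
      using dD \<mu>c W0 \<theta> by (intro mult_left_mono add_left_mono sum_power_reverse_le) auto
    also have "\<dots> = (D / d * sqrt \<mu>) * \<theta> ^ t * norm x0 + (D / d * sqrt \<mu> / (1 - \<theta>)) * W"
      by (simp add: distrib_left mult_ac)
    finally show ?thesis unfolding W_def .
  qed
  show ?thesis
  proof (intro exI conjI allI impI)
    show "0 \<le> D / d * sqrt \<mu>" "0 \<le> D / d * sqrt \<mu> / (1 - \<theta>)" "0 < \<theta>" "\<theta> < 1"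
      using dD \<mu>c \<theta> by auto
  qed (use x_int main in \<open>simp add: Let_def\<close>)
qed

end
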